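(* Let $c_5(n)$ be defined by $\frac{1}{\Psi(-q^5,q)} = \sum_{n=0}^\infty c_5(n) q^n$. Then $$\sum_{n=0}^\infty c_5(2n+1) q^n \equiv_2 \sum_{n \in \mathbb{Z}} q^{n(3n-2)},$$ and therefore, by arithmetic properties of the exponents, for any prime $p>3$ and all $n \geq 0$, it holds that $$c_5(2(pn+j)+1) \equiv 0 \pmod{2}$$ if $3^{-1}(j+3^{-1})$ is not a quadratic residue mod $p$ (where $3^{-1}$ denotes the inverse of $3$ modulo $p$, and $0$ counts as a quadratic residue). For instance, it holds that $$c_5(10n+5) \equiv 0 \pmod{2} \quad \text{and} \quad c_5(10n+9) \equiv 0 \pmod{2}.$$ It also holds that for all $n \geq 0$, $$c_5(8n+5) \equiv 0 \pmod{2},$$ along with many similar congruences in residue classes for powers of $2$.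
   Context: The false theta function is the formal power series in $q$ (for $a,b$ equal to signed powers of $q$) given by $$\Psi(a,b) := \sum_{n=0}^\infty a^{\binom{n+1}{2}} b^{\binom{n}{2}} - \sum_{n=-\infty}^{-1} a^{\binom{n+1}{2}} b^{\binom{n}{2}},$$ where for every integer $n$, $\binom{n+1}{2} = n(n+1)/2$ and $\binom{n}{2} = n(n-1)/2$. The series $\Psi(-q^5,q)$ has constant term $1$, so its reciprocal is a power series with integer coefficients. For power series $f(q)=\sum a(n)q^n$ and $g(q)=\sum b(n)q^n$ with integer coefficients, $f(q) \equiv_m g(q)$ means $a(n) \equiv b(n) \pmod m$ for all $n$. In the congruence for primes $p$, $j$ is a nonnegative integer representing a residue class modulo $p$. *)

theory Defs
  imports "HOL-Analysis.Analysis" "HOL-Number_Theory.Number_Theory"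
begin

text \<open>
  Infinite sums of power series are unordered sums (\<^const>\<open>infsum\<close>) with respect to the library's
  topology on formal power series, in which convergence is eventual constancy of every coefficient
  (\<open>tendsto_fps_iff\<close>). Since \<^const>\<open>infsum\<close> is 0 for a divergent sum, the lemmas below
  show that the sums in question converge.

  For every integer \<open>n\<close> the products \<open>n (n + 1)\<close> and \<open>n (n - 1)\<close> are even and nonnegative,
  so neither the division nor the conversion to \<^typ>\<open>nat\<close> loses information.
\<close>

definition false_theta :: "int fps \<Rightarrow> int fps \<Rightarrow> int fps" where
  "false_theta a b =
     (\<Sum>\<^sub>\<infinity>n\<in>{0::int..}. a ^ nat (n * (n + 1) div 2) * b ^ nat (n * (n - 1) div 2))
   - (\<Sum>\<^sub>\<infinity>n\<in>{..-1::int}. a ^ nat (n * (n + 1) div 2) * b ^ nat (n * (n - 1) div 2))"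

text \<open>
  \<^typ>\<open>int\<close> has no inverse operation, so the reciprocal is the library's inverse of a series
  over a ring, relative to the inverse 1 of its constant term; see \<open>c5_reciprocal\<close>.
\<close>

definition c5 :: "nat \<Rightarrow> int" where
  "c5 n = fps_nth (fps_right_inverse (false_theta (- (fps_X ^ 5)) fps_X) 1) n"

definition fps_cong :: "int \<Rightarrow> int fps \<Rightarrow> int fps \<Rightarrow> bool" where
  "fps_cong m f g \<longleftrightarrow> (\<forall>n. [fps_nth f n = fps_nth g n] (mod m))"

lemma has_sum_fps:
  fixes f :: "'a \<Rightarrow> int fps"
  assumes fin: "\<And>N. finite {n \<in> A. fps_nth (f n) N \<noteq> 0}"
  shows "(f has_sum Abs_fps (\<lambda>N. \<Sum>n | n \<in> A \<and> fps_nth (f n) N \<noteq> 0. fps_nth (f n) N)) A"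
  unfolding has_sum_def
proof (rule tendsto_fpsI)
  fix N
  let ?B = "{n \<in> A. fps_nth (f n) N \<noteq> 0}"
  have "\<forall>\<^sub>F F in finite_subsets_at_top A. finite F \<and> ?B \<subseteq> F \<and> F \<subseteq> A"
    using fin[of N] unfolding eventually_finite_subsets_at_top
    by (intro exI[of _ ?B]) blast
  then show "\<forall>\<^sub>F F in finite_subsets_at_top A. fps_nth (sum f F) N =
      fps_nth (Abs_fps (\<lambda>N. \<Sum>n | n \<in> A \<and> fps_nth (f n) N \<noteq> 0. fps_nth (f n) N)) N"
  proof eventually_elim
    case (elim F)
    then show ?case
      by (auto simp: fps_sum_nth intro!: sum.mono_neutral_right)
  qed
qed

lemma finite_int_abs_le: "finite {n::int. \<bar>n\<bar> \<le> c}"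
  by (rule finite_subset[of _ "{-c..c}"]) auto

lemma false_theta_term:
  "(- (fps_X ^ 5) :: int fps) ^ nat (n * (n + 1) div 2) * fps_X ^ nat (n * (n - 1) div 2)
   = fps_const ((-1) ^ nat (n * (n + 1) div 2)) * fps_X ^ nat (n * (3 * n + 2))"
proof -
  have "even (n * (n + 1))" "even (n * (n - 1))" by auto
  then obtain s t where st: "n * (n + 1) = 2 * s" "n * (n - 1) = 2 * t" by (elim evenE)
  have "0 \<le> n * (n + 1)" "0 \<le> n * (n - 1)" by (auto simp: zero_le_mult_iff)
  then have "0 \<le> s" "0 \<le> t" using st by auto
  moreover have "n * (3 * n + 2) = 5 * s + t" using st by (simp add: algebra_simps)
  ultimately have e: "nat (n * (3 * n + 2)) = 5 * nat s + nat t" by (simp add: nat_add_distrib nat_mult_distrib)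
  have "(- (fps_X ^ 5) :: int fps) ^ nat s = (-1) ^ nat s * fps_X ^ (5 * nat s)"
    by (subst power_minus) (simp add: power_mult)
  moreover have "fps_const ((-1) ^ nat s) = ((-1) ^ nat s :: int fps)"
    by (simp flip: fps_const_power fps_const_neg)
  ultimately show ?thesis by (simp add: st e power_add mult.assoc)
qed

lemma has_sum_false_theta:
  fixes A :: "int set"
  defines "f \<equiv> \<lambda>n. (- (fps_X ^ 5) :: int fps) ^ nat (n * (n + 1) div 2) * fps_X ^ nat (n * (n - 1) div 2)"
  shows "(f has_sum Abs_fps (\<lambda>N. \<Sum>n | n \<in> A \<and> fps_nth (f n) N \<noteq> 0. fps_nth (f n) N)) A"
proof (rule has_sum_fps)
  fix N
  have "\<bar>n\<bar> \<le> int N" if "fps_nth (f n) N \<noteq> 0" for n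
  proof -
    have "N = nat (n * (3 * n + 2))"
      using that by (auto simp: f_def false_theta_term fps_X_power_nth split: if_splits)
    moreover have "\<bar>n\<bar> * 1 \<le> \<bar>n\<bar> * \<bar>3 * n + 2\<bar>" by (intro mult_left_mono) (presburger, simp)
    moreover have "0 \<le> n * (3 * n + 2)" by (auto simp: zero_le_mult_iff)
    ultimately show ?thesis by (simp flip: abs_mult)
  qed
  then show "finite {n \<in> A. fps_nth (f n) N \<noteq> 0}"
    by (intro finite_subset[OF _ finite_int_abs_le[of "int N"]]) auto
qed

lemma has_sum_octagonal:
  defines "f \<equiv> \<lambda>n::int. (fps_X :: int fps) ^ nat (n * (3 * n - 2))"
  shows "(f has_sum Abs_fps (\<lambda>N. \<Sum>n | n \<in> UNIV \<and> fps_nth (f n) N \<noteq> 0. fps_nth (f n) N)) UNIV"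
proof (rule has_sum_fps)
  fix N
  have "\<bar>n\<bar> \<le> int N" if "fps_nth (f n) N \<noteq> 0" for n
  proof -
    have "N = nat (n * (3 * n - 2))"
      using that by (auto simp: f_def fps_X_power_nth split: if_splits)
    moreover have "\<bar>n\<bar> * 1 \<le> \<bar>n\<bar> * \<bar>3 * n - 2\<bar>" by (intro mult_left_mono) (presburger, simp)
    moreover have "0 \<le> n * (3 * n - 2)" by (auto simp: zero_le_mult_iff)
    ultimately show ?thesis by (simp flip: abs_mult)
  qed
  then show "finite {n \<in> UNIV. fps_nth (f n) N \<noteq> 0}"
    by (intro finite_subset[OF _ finite_int_abs_le[of "int N"]]) auto
qed

lemma false_theta_nth_0: "fps_nth (false_theta (- (fps_X ^ 5)) fps_X) 0 = 1"
proof -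
  let ?f = "\<lambda>n. (- (fps_X ^ 5) :: int fps) ^ nat (n * (n + 1) div 2) * fps_X ^ nat (n * (n - 1) div 2)"
  have *: "fps_nth (?f n) 0 \<noteq> 0 \<longleftrightarrow> n = 0" for n :: int
  proof -
    have "n * (3 * n + 2) > 0" if "n \<noteq> 0"
      using that by (auto simp: zero_less_mult_iff)
    then show ?thesis
      by (cases "n = 0") (auto simp: false_theta_term)
  qed
  have "{n \<in> {0::int..}. fps_nth (?f n) 0 \<noteq> 0} = {0}" "{n \<in> {..-1::int}. fps_nth (?f n) 0 \<noteq> 0} = {}"
    unfolding * by auto
  then show ?thesis
    unfolding false_theta_def
    by (simp add: infsumI[OF has_sum_false_theta])
qed

lemma c5_reciprocal: "false_theta (- (fps_X ^ 5)) fps_X * Abs_fps c5 = 1"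
  using fps_right_inverse[of "false_theta (- (fps_X ^ 5)) fps_X" 1]
  by (simp add: c5_def[abs_def] false_theta_nth_0)

end

theory Submission
  imports Defs
begin

text \<open>
  Modulo 2 the signs disappear, so \<open>\<Psi>(-q\<^sup>5, q) \<equiv> F(q)\<close> with \<open>F(q)\<close> the sum of \<open>q^(n(3n-2))\<close> over all
  integers \<open>n\<close>. The exponent is odd iff \<open>n\<close> is odd, and the substitution \<open>n = 1 - 2m\<close> turns the
  odd part of \<open>F(q)\<close> into \<open>q F(q^4)\<close>. Let \<open>C = 1 / F\<close>. Then \<open>C = F C\<^sup>2 \<equiv> F(q) C(q\<^sup>2)\<close>, so the
  odd part of \<open>C\<close> is \<open>q F(q^4) C(q\<^sup>2)\<close>; after replacing \<open>q\<^sup>2\<close> by \<open>q\<close> it becomes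
  \<open>F(q\<^sup>2) C(q) \<equiv> F\<^sup>2 C = F\<close>. The congruences follow because \<open>N = n(3n-2)\<close> means
  \<open>3N + 1 = (3n - 1)\<^sup>2\<close>.
\<close>

section \<open>Congruences and squares of power series modulo 2\<close>

lemma fps_cong_refl: "fps_cong m f f"
  by (simp add: fps_cong_def)

lemma fps_cong_sym: "fps_cong m f g \<Longrightarrow> fps_cong m g f"
  by (simp add: fps_cong_def cong_sym)

lemma fps_cong_trans [trans]: "fps_cong m f g \<Longrightarrow> fps_cong m g h \<Longrightarrow> fps_cong m f h"
  unfolding fps_cong_def by (meson cong_trans)

lemma fps_cong_mult:
  assumes "fps_cong m f f'" "fps_cong m g g'"
  shows "fps_cong m (f * g) (f' * g')"
  using assms unfolding fps_cong_def by (auto simp: fps_mult_nth intro!: cong_sum cong_mult)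

text \<open>In the convolution the terms at \<open>i\<close> and \<open>n - i\<close> are equal, so
  the off-diagonal ones cancel in pairs modulo 2. A diagonal term remains only for even
  \<open>n\<close>; it is a square, and x^2 \<equiv> x modulo 2.\<close>

lemma fps_square_cong:
  fixes f :: "int fps"
  shows "fps_cong 2 (f * f) (Abs_fps (\<lambda>n. if even n then fps_nth f (n div 2) else 0))"
  unfolding fps_cong_def
proof
  fix n
  define h where "h i = fps_nth f i * fps_nth f (n - i)" for i
  define A where "A = {i. 2 * i < n}"
  define B where "B = {i. i \<le> n \<and> n < 2 * i}"
  define D where "D = {i. 2 * i = n}"
  have fin: "finite A" "finite B" "finite D"
    unfolding A_def B_def D_def by (auto intro: finite_subset[of _ "{..n}"])
  have "sum h B = sum h A"
    by (rule sum.reindex_bij_witness[of _ "\<lambda>i. n - i" "\<lambda>i. n - i"])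
       (auto simp: A_def B_def h_def mult.commute)
  moreover have "{0..n} = A \<union> B \<union> D" "A \<inter> B = {}" "(A \<union> B) \<inter> D = {}"
    by (auto simp: A_def B_def D_def)
  ultimately have "fps_nth (f * f) n = 2 * sum h A + sum h D"
    using fin by (simp add: fps_mult_nth sum.union_disjoint flip: h_def)
  moreover have "[sum h D = (if even n then fps_nth f (n div 2) else 0)] (mod 2)"
  proof (cases "even n")
    case True
    then have "D = {n div 2}" by (auto simp: D_def)
    with True show ?thesis
      by (auto simp: h_def cong_def mod2_eq_if elim!: evenE)
  next
    case False
    then have "D = {}" by (auto simp: D_def)
    with False show ?thesis by simp
  qed
  ultimately show "[fps_nth (f * f) n =
      fps_nth (Abs_fps (\<lambda>n. if even n then fps_nth f (n div 2) else 0)) n] (mod 2)"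
    by (simp add: cong_def)
qed

text \<open>Modulo 2, \<open>g\<close> is h(q^2), a series in even powers only. Taking the odd part
  of \<open>f * g\<close> therefore acts on \<open>f\<close> alone, and replacing q^2 by q turns
  \<open>g\<close> into \<open>h\<close>.\<close>

lemma fps_odd_part_cong:
  fixes f g :: "int fps"
  assumes "fps_cong 2 g (Abs_fps (\<lambda>n. if even n then fps_nth h (n div 2) else 0))"
  shows "fps_cong 2 (Abs_fps (\<lambda>n. fps_nth (f * g) (2 * n + 1)))
           (Abs_fps (\<lambda>n. fps_nth f (2 * n + 1)) * h)"
  unfolding fps_cong_def
proof
  fix n
  define e where "e = Abs_fps (\<lambda>n. if even n then fps_nth h (n div 2) else 0)"
  have "fps_nth (f * e) (2 * n + 1) = (\<Sum>i\<in>{0..2*n+1}. fps_nth f i * fps_nth e (2 * n + 1 - i))"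
    by (simp add: fps_mult_nth)
  \<comment> \<open>For even \<open>i\<close> the index \<open>2 * n + 1 - i\<close> is odd, where
    \<open>e\<close> vanishes.\<close>
  also have "\<dots> = (\<Sum>i\<in>{i\<in>{0..2*n+1}. odd i}. fps_nth f i * fps_nth e (2 * n + 1 - i))"
    by (rule sum.mono_neutral_right) (auto simp: e_def)
  also have "\<dots> = (\<Sum>k\<in>{0..n}. fps_nth f (2 * k + 1) * fps_nth h (n - k))"
    by (rule sum.reindex_bij_witness[of _ "\<lambda>k. 2 * k + 1" "\<lambda>i. i div 2"])
       (auto simp: e_def elim!: oddE simp flip: diff_mult_distrib2)
  finally have "fps_nth (f * e) (2 * n + 1)
      = fps_nth (Abs_fps (\<lambda>n. fps_nth f (2 * n + 1)) * h) n"
    by (simp add: fps_mult_nth)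
  moreover have "fps_cong 2 (f * g) (f * e)"
    using assms by (auto intro: fps_cong_mult fps_cong_refl simp: e_def)
  ultimately show "[fps_nth (Abs_fps (\<lambda>n. fps_nth (f * g) (2 * n + 1))) n =
      fps_nth (Abs_fps (\<lambda>n. fps_nth f (2 * n + 1)) * h) n] (mod 2)"
    by (metis fps_cong_def fps_nth_Abs_fps)
qed

section \<open>Generalized octagonal numbers and their theta series\<close>

definition octagonal :: "int \<Rightarrow> bool" where
  "octagonal N \<longleftrightarrow> (\<exists>n. n * (3 * n - 2) = N)"

definition octagonal_fps :: "int fps" where
  "octagonal_fps = Abs_fps (\<lambda>N. of_bool (octagonal (int N)))"

lemma octagonal_inj:
  fixes m n :: int
  assumes "m * (3 * m - 2) = n * (3 * n - 2)"
  shows "m = n"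
proof -
  have "(m - n) * (3 * (m + n) - 2) = 0"
    using assms by (simp add: algebra_simps)
  \<comment> \<open>This factor is 1 modulo 3.\<close>
  moreover have "3 * (m + n) - 2 \<noteq> 0" by presburger
  ultimately show ?thesis by simp
qed

lemma octagonal_nonneg: "0 \<le> n * (3 * n - 2)" for n :: int
  by (auto simp: zero_le_mult_iff)

lemma octagonal_odd_iff: "octagonal (2 * N + 1) \<longleftrightarrow> even N \<and> octagonal (N div 2)"
proof
  assume "octagonal (2 * N + 1)"
  then obtain n where n: "n * (3 * n - 2) = 2 * N + 1" by (auto simp: octagonal_def)
  then have "odd (n * (3 * n - 2))" by simp
  then have "odd n" by auto
  then obtain k where "n = 2 * k + 1" by (rule oddE)
  \<comment> \<open>With m = -k this is n = 1 - 2m, for which n(3n-2) = 4m(3m-2) + 1.\<close>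
  with n have N: "N = 2 * (- k * (3 * - k - 2))" by (simp add: algebra_simps)
  then have "N div 2 = - k * (3 * - k - 2)" by simp
  with N show "even N \<and> octagonal (N div 2)" unfolding octagonal_def by (metis dvd_triv_left)
next
  assume *: "even N \<and> octagonal (N div 2)"
  then obtain m where m: "m * (3 * m - 2) = N div 2" by (auto simp: octagonal_def)
  from * have "N = 2 * (N div 2)" by simp
  with m have "(1 - 2 * m) * (3 * (1 - 2 * m) - 2) = 2 * N + 1" by (simp add: algebra_simps)
  then show "octagonal (2 * N + 1)" unfolding octagonal_def by blast
qed

text \<open>By \<open>octagonal_inj\<close> at most one integer contributes to each coefficient, so
  all coefficients are 0 or 1.\<close>

lemma infsum_octagonal: "(\<Sum>\<^sub>\<infinity>n\<in>(UNIV :: int set). fps_X ^ nat (n * (3 * n - 2))) = octagonal_fps"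
proof -
  have "(\<Sum>n | n \<in> UNIV \<and> fps_nth (fps_X ^ nat (n * (3 * n - 2)) :: int fps) N \<noteq> 0.
          fps_nth (fps_X ^ nat (n * (3 * n - 2)) :: int fps) N) = of_bool (octagonal (int N))" for N
  proof -
    have eq: "fps_nth (fps_X ^ nat (n * (3 * n - 2)) :: int fps) N
        = of_bool (n * (3 * n - 2) = int N)" for n
      using octagonal_nonneg[of n] by (auto simp: fps_X_power_nth)
    show ?thesis
    proof (cases "octagonal (int N)")
      case True
      then obtain n where n: "n * (3 * n - 2) = int N" by (auto simp: octagonal_def)
      then have "{m. m * (3 * m - 2) = int N} = {n}"
        using octagonal_inj by (metis (mono_tags, lifting) Collect_cong singleton_conv)
      with True show ?thesis unfolding eq by simp
    next
      case False
      then show ?thesis unfolding eq by (simp add: octagonal_def)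
    qed
  qed
  then show ?thesis
    by (simp add: infsumI[OF has_sum_octagonal] octagonal_fps_def)
qed

text \<open>The exponent n(3n+2) of the false theta series is the octagonal exponent at -n. Distinct
  indices never share an exponent, so each coefficient is 0 or a single sign, and only its parity
  matters.\<close>

lemma false_theta_cong: "fps_cong 2 (false_theta (- (fps_X ^ 5)) fps_X) octagonal_fps"
  unfolding fps_cong_def
proof
  fix N
  let ?f = "\<lambda>n. (- (fps_X ^ 5) :: int fps) ^ nat (n * (n + 1) div 2) * fps_X ^ nat (n * (n - 1) div 2)"
  define S where "S A = (\<Sum>n | n \<in> A \<and> fps_nth (?f n) N \<noteq> 0. fps_nth (?f n) N)" for A
  have nz: "fps_nth (?f n) N \<noteq> 0 \<longleftrightarrow> - n * (3 * - n - 2) = int N" for n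
  proof -
    have "- n * (3 * - n - 2) = n * (3 * n + 2)" by (simp add: algebra_simps)
    with octagonal_nonneg[of "- n"] show ?thesis
      by (auto simp: false_theta_term fps_X_power_nth)
  qed
  have odd: "odd (fps_nth (?f n) N)" if "fps_nth (?f n) N \<noteq> 0" for n
    using that by (auto simp: false_theta_term fps_X_power_nth split: if_splits)
  have "odd (S {0..} - S {..-1}) \<longleftrightarrow> octagonal (int N)"
  proof (cases "octagonal (int N)")
    case True
    then obtain n where n: "n * (3 * n - 2) = int N" by (auto simp: octagonal_def)
    have supp: "fps_nth (?f m) N \<noteq> 0 \<longleftrightarrow> m = - n" for m
      unfolding nz using n octagonal_inj[of "- m" n] by auto
    have "{m. m \<in> A \<and> m = - n} = (if - n \<in> A then {- n} else {})" for A
      by auto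
    then have "S A = (if - n \<in> A then fps_nth (?f (- n)) N else 0)" for A
      unfolding S_def supp by simp
    moreover have "odd (fps_nth (?f (- n)) N)"
      using odd supp by blast
    \<comment> \<open>The index \<open>- n\<close> lies in exactly one of the two half-lines, so one
      of the two sums is odd and the other is 0.\<close>
    ultimately show ?thesis using True
      by (cases "n \<le> 0") (simp_all only: atLeast_iff atMost_iff, simp_all)
  next
    case False
    then have "fps_nth (?f n) N = 0" for n
      using nz[of n] unfolding octagonal_def by blast
    with False show ?thesis by (simp add: S_def)
  qed
  moreover have "fps_nth (false_theta (- (fps_X ^ 5)) fps_X) N = S {0..} - S {..-1}"
    unfolding false_theta_def S_def by (simp add: infsumI[OF has_sum_false_theta])
  ultimately show "[fps_nth (false_theta (- (fps_X ^ 5)) fps_X) N = fps_nth octagonal_fps N] (mod 2)"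
    by (auto simp: octagonal_fps_def cong_def mod2_eq_if)
qed

text \<open>In terms of series, the odd part of F(q) is q F(q^4), which becomes F(q^2) once q is
  divided out and q^2 is replaced by q.\<close>

lemma octagonal_fps_odd_part:
  "Abs_fps (\<lambda>n. fps_nth octagonal_fps (2 * n + 1))
   = Abs_fps (\<lambda>n. if even n then fps_nth octagonal_fps (n div 2) else 0)"
proof (rule fps_ext)
  fix n
  have "octagonal (int (2 * n + 1)) \<longleftrightarrow> even n \<and> octagonal (int (n div 2))"
    using octagonal_odd_iff[of "int n"] by (simp add: zdiv_int add.commute)
  then show "fps_nth (Abs_fps (\<lambda>n. fps_nth octagonal_fps (2 * n + 1))) n
      = fps_nth (Abs_fps (\<lambda>n. if even n then fps_nth octagonal_fps (n div 2) else 0)) n"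
    by (simp add: octagonal_fps_def)
qed

section \<open>The odd part of the reciprocal modulo 2\<close>

lemma c5_odd_cong: "fps_cong 2 (Abs_fps (\<lambda>n. c5 (2 * n + 1))) octagonal_fps"
proof -
  let ?F = "false_theta (- (fps_X ^ 5)) fps_X" and ?C = "Abs_fps c5" and ?O = octagonal_fps
  have "?C = ?F * (?C * ?C)"
    using c5_reciprocal by (simp flip: mult.assoc)
  then have "c5 n = fps_nth (?F * (?C * ?C)) n" for n
    by (metis fps_nth_Abs_fps)
  then have "fps_cong 2 (Abs_fps (\<lambda>n. c5 (2 * n + 1))) (Abs_fps (\<lambda>n. fps_nth ?F (2 * n + 1)) * ?C)"
    using fps_odd_part_cong[OF fps_square_cong, of ?F ?C] by simp
  also have "fps_cong 2 (Abs_fps (\<lambda>n. fps_nth ?F (2 * n + 1))) (Abs_fps (\<lambda>n. fps_nth ?O (2 * n + 1)))"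
    using false_theta_cong by (simp add: fps_cong_def)
  \<comment> \<open>The squaring congruence is read backwards here: the odd part, a series in q^2,
    becomes \<open>?O * ?O\<close>, and one factor can then cancel against
    \<open>?C\<close>.\<close>
  then have "fps_cong 2 (Abs_fps (\<lambda>n. fps_nth ?F (2 * n + 1)) * ?C) (?O * ?O * ?C)"
    unfolding octagonal_fps_odd_part
    by (blast intro: fps_cong_mult fps_cong_refl fps_cong_trans fps_cong_sym[OF fps_square_cong])
  also have "fps_cong 2 (?O * ?O * ?C) (?O * (?F * ?C))"
    unfolding mult.assoc
    by (intro fps_cong_mult fps_cong_refl fps_cong_sym[OF false_theta_cong])
  also have "?O * (?F * ?C) = ?O"
    by (simp add: c5_reciprocal)
  finally show ?thesis .
qed

section \<open>Even coefficients in arithmetic progressions\<close>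

lemma c5_even_if_not_octagonal:
  assumes "\<not> octagonal (int N)"
  shows "[c5 (2 * N + 1) = 0] (mod 2)"
proof -
  have "[c5 (2 * N + 1) = of_bool (octagonal (int N))] (mod 2)"
    using c5_odd_cong by (simp add: fps_cong_def octagonal_fps_def)
  with assms show ?thesis by simp
qed

text \<open>Multiplying (3n-1)^2 = 3N + 1 by i^2, where i inverts 3, gives (n-i)^2 \<equiv>
  i(N+i).\<close>

lemma QuadRes_if_octagonal:
  fixes m i j N :: int
  assumes "octagonal N" "[3 * i = 1] (mod m)" "[N = j] (mod m)"
  shows "QuadRes m (i * (j + i))"
proof -
  obtain n where n: "N = n * (3 * n - 2)"
    using assms(1) by (auto simp: octagonal_def)
  have "(n - i)\<^sup>2 = 1 * n\<^sup>2 - 2 * n * i + i * i"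
    by (simp add: power2_eq_square algebra_simps)
  \<comment> \<open>Replacing the coefficient 1 by \<open>3 * i\<close> makes \<open>i\<close> a
    common factor, with cofactor 3n^2 - 2n + i = N + i.\<close>
  also have "[\<dots> = (3 * i) * n\<^sup>2 - 2 * n * i + i * i] (mod m)"
    by (intro cong_add cong_diff cong_mult cong_refl cong_sym[OF assms(2)])
  also have "(3 * i) * n\<^sup>2 - 2 * n * i + i * i = i * (N + i)"
    by (simp add: n power2_eq_square algebra_simps)
  also have "[\<dots> = i * (j + i)] (mod m)"
    by (intro cong_add cong_mult cong_refl assms(3))
  finally show ?thesis by (auto simp: QuadRes_def)
qed

text \<open>Stated for any modulus coprime to 3, so that it serves both the primes p > 3 and the
  powers of 2.\<close>

lemma c5_even_if_not_QuadRes: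
  fixes m j n :: nat
  assumes "coprime 3 (int m)"
    and "\<not> QuadRes (int m) (modular_inverse (int m) 3 * (int j + modular_inverse (int m) 3))"
  shows "[c5 (2 * (m * n + j) + 1) = 0] (mod 2)"
proof (rule c5_even_if_not_octagonal)
  have "[3 * modular_inverse (int m) 3 = 1] (mod int m)"
    using assms(1) by (simp add: cong_modular_inverse1)
  moreover have "[int (m * n + j) = int j] (mod int m)"
    by (simp add: cong_def)
  ultimately show "\<not> octagonal (int (m * n + j))"
    using assms(2) QuadRes_if_octagonal by blast
qed

lemma square_if_octagonal:
  assumes "octagonal N"
  shows "\<exists>y. y\<^sup>2 = 3 * N + 1"
proof -
  obtain n where "n * (3 * n - 2) = N" using assms by (auto simp: octagonal_def)
  then have "(3 * n - 1)\<^sup>2 = 3 * N + 1" by (auto simp: power2_eq_square algebra_simps)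
  then show ?thesis by blast
qed

lemma square_mod_5: "y\<^sup>2 mod 5 \<in> {0, 1, 4}" for y :: int
proof -
  have "y mod 5 = 0 \<or> y mod 5 = 1 \<or> y mod 5 = 2 \<or> y mod 5 = 3 \<or> y mod 5 = 4" by presburger
  moreover have "y\<^sup>2 mod 5 = (y mod 5)\<^sup>2 mod 5" by (simp add: power_mod)
  ultimately show ?thesis by auto
qed

lemma square_mod_4: "y\<^sup>2 mod 4 \<in> {0, 1}" for y :: int
proof -
  have "y mod 4 = 0 \<or> y mod 4 = 1 \<or> y mod 4 = 2 \<or> y mod 4 = 3" by presburger
  moreover have "y\<^sup>2 mod 4 = (y mod 4)\<^sup>2 mod 4" by (simp add: power_mod)
  ultimately show ?thesis by auto
qed

lemma c5_even_mod_10: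
  shows "[c5 (10 * n + 5) = 0] (mod 2)" and "[c5 (10 * n + 9) = 0] (mod 2)"
proof -
  \<comment> \<open>For \<open>r = 2\<close> and \<open>r = 4\<close>, 3N + 1 is 2 and 3 modulo 5,
    the two non-squares.\<close>
  have "\<not> octagonal (int (5 * n + r))" if "r = 2 \<or> r = 4" for r
  proof
    assume "octagonal (int (5 * n + r))"
    then obtain y where "y\<^sup>2 = 3 * int (5 * n + r) + 1" using square_if_octagonal by blast
    with square_mod_5[of y] have "(3 * int (5 * n + r) + 1) mod 5 \<in> {0, 1, 4}" by simp
    with that show False by (auto; presburger)
  qed
  then have "[c5 (2 * (5 * n + 2) + 1) = 0] (mod 2)" "[c5 (2 * (5 * n + 4) + 1) = 0] (mod 2)"
    by (simp_all only: c5_even_if_not_octagonal simp_thms)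
  moreover have "2 * (5 * n + 2) + 1 = 10 * n + 5" "2 * (5 * n + 4) + 1 = 10 * n + 9"
    by simp_all
  ultimately show "[c5 (10 * n + 5) = 0] (mod 2)" "[c5 (10 * n + 9) = 0] (mod 2)"
    by (simp_all only:)
qed

lemma c5_even_mod_8: "[c5 (8 * n + 5) = 0] (mod 2)"
proof -
  \<comment> \<open>Here 3N + 1 = 12n + 7 is 3 modulo 4, which is not a square.\<close>
  have "\<not> octagonal (int (4 * n + 2))"
  proof
    assume "octagonal (int (4 * n + 2))"
    then obtain y where "y\<^sup>2 = 3 * int (4 * n + 2) + 1" using square_if_octagonal by blast
    with square_mod_4[of y] have "(3 * int (4 * n + 2) + 1) mod 4 \<in> {0, 1}" by simp
    then show False by (auto; presburger)
  qed
  then have "[c5 (2 * (4 * n + 2) + 1) = 0] (mod 2)"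
    by (rule c5_even_if_not_octagonal)
  moreover have "2 * (4 * n + 2) + 1 = 8 * n + 5"
    by simp
  ultimately show ?thesis by (simp only:)
qed

theorem theorem1:
  shows "fps_cong 2 (Abs_fps (\<lambda>n. c5 (2 * n + 1)))
           (\<Sum>\<^sub>\<infinity>n\<in>(UNIV :: int set). fps_X ^ nat (n * (3 * n - 2)))
    \<and> (\<forall>p j :: nat. prime p \<longrightarrow> p > 3 \<longrightarrow>
          \<not> QuadRes (int p)
              (modular_inverse (int p) 3 * (int j + modular_inverse (int p) 3)) \<longrightarrow>
          (\<forall>n. [c5 (2 * (p * n + j) + 1) = 0] (mod 2)))
    \<and> (\<forall>n. [c5 (10 * n + 5) = 0] (mod 2))
    \<and> (\<forall>n. [c5 (10 * n + 9) = 0] (mod 2))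
    \<and> (\<forall>n. [c5 (8 * n + 5) = 0] (mod 2))
    \<and> (\<forall>k j :: nat.
          \<not> QuadRes (2 ^ k)
              (modular_inverse (2 ^ k) 3 * (int j + modular_inverse (2 ^ k) 3)) \<longrightarrow>
          (\<forall>n. [c5 (2 * (2 ^ k * n + j) + 1) = 0] (mod 2)))"
proof (intro conjI allI impI)
  show "fps_cong 2 (Abs_fps (\<lambda>n. c5 (2 * n + 1)))
      (\<Sum>\<^sub>\<infinity>n\<in>(UNIV :: int set). fps_X ^ nat (n * (3 * n - 2)))"
    by (simp only: infsum_octagonal c5_odd_cong)
next
  fix p j n :: nat
  assume "prime p" "p > 3"
    and "\<not> QuadRes (int p) (modular_inverse (int p) 3 * (int j + modular_inverse (int p) 3))"
  moreover from this have "coprime 3 (int p)"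
    using primes_coprime[of 3 p] by (simp flip: coprime_int_iff)
  ultimately show "[c5 (2 * (p * n + j) + 1) = 0] (mod 2)"
    by (intro c5_even_if_not_QuadRes)
next
  \<comment> \<open>This family makes the similar congruences for powers of 2 precise;
    \<open>k = 2\<close>, \<open>j = 2\<close> gives the progression 8n + 5 again.\<close>
  fix k j n :: nat
  assume "\<not> QuadRes (2 ^ k) (modular_inverse (2 ^ k) 3 * (int j + modular_inverse (2 ^ k) 3))"
  then show "[c5 (2 * (2 ^ k * n + j) + 1) = 0] (mod 2)"
    using c5_even_if_not_QuadRes[of "2 ^ k" j n] by simp
qed (rule c5_even_mod_10 c5_even_mod_8)+

end
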